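(* Let $\mathbf c=(c_j)_{j\ge1}$ be a sequence of non-negative integers. Then $S_{\mathbf c}(n)\equiv 0\pmod 3$ for every integer $n\ge 1$ if and only if $c_j\equiv 0\pmod 3$ for every $j\ge1$ with $3\nmid j$ (with no restriction on $c_j$ when $3\mid j$).
   Context: For a sequence $\mathbf c=(c_j)_{j\ge1}$ of non-negative integers, a colour partition of $n$ of type $\mathcal P_{\mathbf c}$ is a partition of $n$ in which each part of size $j$ may appear in any of $c_j$ different colours (no part of size $j$ is allowed if $c_j=0$); formally, it is a finite multiset of pairs $(j,i)$ with $j\ge1$, $1\le i\le c_j$, whose first components sum to $n$. $S_{\mathbf c}(n)$ is the sum of all odd parts minus the sum of all even parts, taken over all colour partitions of $n$ of type $\mathcal P_{\mathbf c}$ (parts counted with multiplicity). *)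

theory Defs
  imports "HOL-Library.Multiset" "HOL-Number_Theory.Cong"
begin

text \<open>A part is a pair \<open>(j, i)\<close> of a size \<open>j\<close> and a colour \<open>i\<close>.  The sequence \<open>(c\<^sub>j)\<close> is indexed
  by \<open>j \<ge> 1\<close>; the value \<open>c 0\<close> is never used.\<close>

definition colour_partitions :: "(nat \<Rightarrow> nat) \<Rightarrow> nat \<Rightarrow> (nat \<times> nat) multiset set" where
  "colour_partitions c n =
     {P. (\<forall>(j, i) \<in># P. 1 \<le> j \<and> 1 \<le> i \<and> i \<le> c j) \<and> (\<Sum>x\<in>#P. fst x) = n}"

definition odd_minus_even :: "(nat \<times> nat) multiset \<Rightarrow> int" where
  "odd_minus_even P =
     (\<Sum>x\<in>#filter_mset (\<lambda>x. odd (fst x)) P. int (fst x))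
     - (\<Sum>x\<in>#filter_mset (\<lambda>x. even (fst x)) P. int (fst x))"

definition S :: "(nat \<Rightarrow> nat) \<Rightarrow> nat \<Rightarrow> int" where
  "S c n = (\<Sum>P\<in>colour_partitions c n. odd_minus_even P)"

text \<open>The sum defining \<open>S\<close> ranges over a finite set.\<close>

lemma finite_colour_partitions: "finite (colour_partitions c n)"
proof -
  define A where "A = (SIGMA j:{1..n}. {1..c j})"
  have fin: "finite A" unfolding A_def by auto
  have "P \<in> mset ` {xs. set xs \<subseteq> A \<and> length xs \<le> n}" if "P \<in> colour_partitions c n" for P
  proof -
    have pos: "\<forall>x\<in>#P. 1 \<le> fst x \<and> 1 \<le> snd x \<and> snd x \<le> c (fst x)"
      and tot: "(\<Sum>x\<in>#P. fst x) = n"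
      using that by (auto simp: colour_partitions_def case_prod_beta)
    have le: "fst x \<le> n" if "x \<in># P" for x
      using multi_member_split[OF that] tot by auto
    have "size P \<le> (\<Sum>x\<in>#P. fst x)"
      using pos by (induction P) (auto simp: Suc_le_eq)
    moreover have "set_mset P \<subseteq> A"
      using pos le by (fastforce simp: A_def)
    moreover obtain xs where "mset xs = P" using ex_mset by blast
    ultimately show ?thesis using tot by (intro image_eqI[of _ _ xs]) auto
  qed
  then show ?thesis
    using finite_lists_length_le[OF fin, of n] by (meson finite_imageI finite_subset subsetI)
qed

end

theory Submission
  imports Defs
begin

text \<open>Counting how often a given coloured part of size \<open>j\<close> occurs in all colour partitions of \<open>n\<close>
  gives a number \<open>Q\<^sub>j(n)\<close> independent of the colour, so \<open>S\<^sub>c(n)\<close> is the sum of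
  \<open>\<plusminus> j c\<^sub>j Q\<^sub>j(n)\<close> over \<open>j \<le> n\<close>.  Since \<open>Q\<^sub>n(n) = 1\<close> this system is unitriangular in the quantities
  \<open>\<plusminus> j c\<^sub>j\<close>, so all \<open>S\<^sub>c(n)\<close> vanish modulo \<open>3\<close> exactly when all \<open>j c\<^sub>j\<close> do.\<close>

definition signed_size :: "nat \<Rightarrow> int" where
  "signed_size j = (if odd j then int j else - int j)"

text \<open>This is the Q_j(n) of the idea. Its k-th summand is meant to count the partitions of
  \<open>n\<close> that contain a fixed coloured part of size \<open>j\<close> at least
  \<open>k\<close> times. The bound by \<open>n\<close> keeps the index set finite even at
  \<open>j = 0\<close>.\<close>

definition part_occurrences :: "(nat \<Rightarrow> nat) \<Rightarrow> nat \<Rightarrow> nat \<Rightarrow> nat" where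
  "part_occurrences c n j =
     (\<Sum>k | k \<in> {1..n} \<and> k * j \<le> n. card (colour_partitions c (n - k * j)))"

lemma three_dvd_signed_size_iff: "3 dvd signed_size j \<longleftrightarrow> 3 dvd j"
  unfolding signed_size_def by (auto simp: int_dvd_int_iff[of 3, simplified])

lemma odd_minus_even_eq_sum_mset: "odd_minus_even P = (\<Sum>x\<in>#P. signed_size (fst x))"
  by (induction P) (auto simp: odd_minus_even_def signed_size_def)

text \<open>Replaces the index multiset, which varies with \<open>P\<close>, by a fixed set
  \<open>A\<close>, so that the sum can later be swapped with a sum over all
  \<open>P\<close>.\<close>

lemma sum_mset_eq_sum_count:
  fixes f :: "'a \<Rightarrow> 'b::comm_semiring_1"
  assumes "finite A" "set_mset P \<subseteq> A"
  shows "(\<Sum>x\<in>#P. f x) = (\<Sum>x\<in>A. of_nat (count P x) * f x)"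
  using assms(2)
proof (induction P)
  case (add y P)
  have "(\<Sum>x\<in>A. of_nat (count (add_mset y P) x) * f x)
      = (\<Sum>x\<in>A. (if x = y then f x else 0) + of_nat (count P x) * f x)"
    by (intro sum.cong) (auto simp: algebra_simps)
  also have "\<dots> = f y + (\<Sum>x\<in>A. of_nat (count P x) * f x)"
    using add.prems assms(1) by (simp add: sum.distrib sum.delta)
  finally show ?case using add by simp
qed simp

text \<open>The copies of \<open>(j, i)\<close> form a submultiset of \<open>P\<close>, and the
  remaining parts contribute a non-negative amount to the total \<open>n\<close>.\<close>

lemma count_mult_size_le:
  assumes "P \<in> colour_partitions c n"
  shows "count P (j, i) * j \<le> n"
proof -
  have "replicate_mset (count P (j, i)) (j, i) \<subseteq># P"
    by (simp flip: count_le_replicate_mset_subset_eq)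
  then obtain R where "P = replicate_mset (count P (j, i)) (j, i) + R"
    by (auto simp: subset_mset.le_iff_add)
  then have "(\<Sum>x\<in>#P. fst x) = count P (j, i) * j + (\<Sum>x\<in>#R. fst x)"
    by (drule_tac arg_cong[of _ _ "\<lambda>P. \<Sum>x\<in>#P. fst x"]) simp
  then show ?thesis using assms by (simp add: colour_partitions_def)
qed

lemma set_mset_colour_partition:
  assumes "P \<in> colour_partitions c n"
  shows "set_mset P \<subseteq> (SIGMA j:{1..n}. {1..c j})"
proof
  fix x assume x: "x \<in># P"
  obtain j i where [simp]: "x = (j, i)" by fastforce
  have "1 \<le> count P (j, i)" using x by (simp add: Suc_le_eq)
  then have "1 * j \<le> count P (j, i) * j" by (rule mult_le_mono1)
  also have "\<dots> \<le> n" using assms by (rule count_mult_size_le)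
  finally show "x \<in> (SIGMA j:{1..n}. {1..c j})"
    using assms x by (fastforce simp: colour_partitions_def)
qed

text \<open>Adding \<open>k\<close> copies of \<open>(j, i)\<close> is a bijection whose inverse
  removes them. The bounds on \<open>j\<close> and \<open>i\<close> make the added parts
  admissible.\<close>

lemma card_colour_partitions_count_ge:
  assumes "1 \<le> j" "1 \<le> i" "i \<le> c j" "k * j \<le> n"
  shows "card {P \<in> colour_partitions c n. k \<le> count P (j, i)} = card (colour_partitions c (n - k * j))"
proof -
  let ?R = "replicate_mset k (j, i)"
  have sumR: "(\<Sum>x\<in>#P + ?R. fst x) = (\<Sum>x\<in>#P. fst x) + k * j" for P :: "(nat \<times> nat) multiset"
    by simp
  have "bij_betw (\<lambda>P. P + ?R) (colour_partitions c (n - k * j))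
          {P \<in> colour_partitions c n. k \<le> count P (j, i)}"
  proof (rule bij_betw_byWitness[where f' = "\<lambda>P. P - ?R"])
    show "\<forall>P\<in>{P \<in> colour_partitions c n. k \<le> count P (j, i)}. P - ?R + ?R = P"
      by (auto simp: count_le_replicate_mset_subset_eq)
    show "(\<lambda>P. P + ?R) ` colour_partitions c (n - k * j)
        \<subseteq> {P \<in> colour_partitions c n. k \<le> count P (j, i)}"
      using assms by (auto simp: colour_partitions_def split: if_splits)
    show "(\<lambda>P. P - ?R) ` {P \<in> colour_partitions c n. k \<le> count P (j, i)}
        \<subseteq> colour_partitions c (n - k * j)"
    proof clarify
      fix P assume P: "P \<in> colour_partitions c n" "k \<le> count P (j, i)"
      \<comment> \<open>Multiset difference truncates; the lower bound on the count ensures that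
        exactly \<open>k\<close> copies are removed.\<close>
      then have "P - ?R + ?R = P" by (simp add: count_le_replicate_mset_subset_eq)
      then have "(\<Sum>x\<in>#P - ?R. fst x) + k * j = n"
        using sumR[of "P - ?R"] P(1) by (simp add: colour_partitions_def)
      then show "P - ?R \<in> colour_partitions c (n - k * j)"
        using P(1) by (auto simp: colour_partitions_def dest!: in_diffD)
    qed
  qed simp
  then show ?thesis by (simp add: bij_betw_same_card)
qed

text \<open>Double counting: a multiplicity m is the number of \<open>k\<close> with 1 \<le> k \<le>
  m. After swapping the sums, each \<open>k\<close> contributes a cardinality that does not depend
  on the colour \<open>i\<close>.\<close>

lemma sum_count_colour_partitions:
  assumes "1 \<le> j" "1 \<le> i" "i \<le> c j"
  shows "(\<Sum>P\<in>colour_partitions c n. count P (j, i)) = part_occurrences c n j"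
proof -
  let ?K = "{k. k \<in> {1..n} \<and> k * j \<le> n}"
  have count: "count P (j, i) = (\<Sum>k\<in>?K. of_bool (k \<le> count P (j, i)))"
    if "P \<in> colour_partitions c n" for P
  proof -
    have le: "count P (j, i) * j \<le> n"
      using that by (rule count_mult_size_le)
    \<comment> \<open>The index set misses no relevant \<open>k\<close>: since j \<ge> 1, the bound
      on \<open>k * j\<close> also bounds \<open>k\<close> by \<open>n\<close>.\<close>
    have "k \<in> ?K" if k: "1 \<le> k" "k \<le> count P (j, i)" for k
    proof -
      have "k * j \<le> n" using mult_le_mono1[OF k(2), of j] le by linarith
      moreover have "k * 1 \<le> k * j" using assms(1) by (intro mult_le_mono2)
      ultimately have "k \<le> n" by linarith
      then show ?thesis using k(1) \<open>k * j \<le> n\<close> by simp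
    qed
    then have "{k \<in> ?K. k \<le> count P (j, i)} = {1..count P (j, i)}" by auto
    then have "card {k \<in> ?K. k \<le> count P (j, i)} = count P (j, i)" by simp
    moreover have "finite ?K" by simp
    ultimately show ?thesis by (simp add: sum_of_bool_eq Int_def conj_ac)
  qed
  have "(\<Sum>P\<in>colour_partitions c n. count P (j, i))
      = (\<Sum>P\<in>colour_partitions c n. \<Sum>k\<in>?K. of_bool (k \<le> count P (j, i)))"
    by (rule sum.cong[OF refl]) (rule count)
  also have "\<dots> = (\<Sum>k\<in>?K. \<Sum>P\<in>colour_partitions c n. of_bool (k \<le> count P (j, i)))"
    by (rule sum.swap)
  also have "\<dots> = (\<Sum>k\<in>?K. card {P \<in> colour_partitions c n. k \<le> count P (j, i)})"
    by (simp add: sum_of_bool_eq finite_colour_partitions Int_def)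
  also have "\<dots> = part_occurrences c n j"
    unfolding part_occurrences_def
    using assms by (intro sum.cong) (auto intro: card_colour_partitions_count_ge)
  finally show ?thesis .
qed

text \<open>Swap the sums over partitions and over coloured parts. All colours of size
  \<open>j\<close> then contribute equally, which yields the factor \<open>c j\<close>.\<close>

lemma S_eq_sum_part_occurrences:
  "S c n = (\<Sum>j = 1..n. signed_size j * int (c j) * int (part_occurrences c n j))"
proof -
  let ?A = "SIGMA j:{1..n}. {1..c j}"
  have "S c n = (\<Sum>P\<in>colour_partitions c n. \<Sum>x\<in>?A. int (count P x) * signed_size (fst x))"
    unfolding S_def odd_minus_even_eq_sum_mset
    by (intro sum.cong refl sum_mset_eq_sum_count set_mset_colour_partition) auto
  also have "\<dots> = (\<Sum>x\<in>?A. \<Sum>P\<in>colour_partitions c n. int (count P x) * signed_size (fst x))"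
    by (rule sum.swap)
  also have "\<dots> = (\<Sum>x\<in>?A. int (part_occurrences c n (fst x)) * signed_size (fst x))"
    by (intro sum.cong refl)
      (auto simp: sum_count_colour_partitions simp flip: sum_distrib_right of_nat_sum)
  also have "\<dots> = (\<Sum>j = 1..n. \<Sum>i = 1..c j. int (part_occurrences c n j) * signed_size j)"
    by (subst sum.Sigma) (auto simp: case_prod_beta)
  also have "\<dots> = (\<Sum>j = 1..n. signed_size j * int (c j) * int (part_occurrences c n j))"
    by (simp add: algebra_simps)
  finally show ?thesis .
qed

lemma colour_partitions_0: "colour_partitions c 0 = {{#}}"
proof -
  have "P = {#}" if "P \<in> colour_partitions c 0" for P
    using set_mset_colour_partition[OF that] by simp
  then show ?thesis by (auto simp: colour_partitions_def)
qed

text \<open>Only \<open>k = 1\<close> fits, leaving the empty partition. This is the unit diagonal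
  of the triangular system.\<close>

lemma part_occurrences_self:
  assumes "1 \<le> n"
  shows "part_occurrences c n n = 1"
proof -
  have "{k. k \<in> {1..n} \<and> k * n \<le> n} = {1}" using assms by auto
  then show ?thesis by (simp add: part_occurrences_def colour_partitions_0)
qed

theorem corollary5p3:
  fixes c :: "nat \<Rightarrow> nat"
  shows "(\<forall>n\<ge>1. [S c n = 0] (mod 3)) \<longleftrightarrow> (\<forall>j\<ge>1. \<not> 3 dvd j \<longrightarrow> [c j = 0] (mod 3))"
proof -
  let ?w = "\<lambda>j. signed_size j * int (c j)"
  \<comment> \<open>As 3 is prime, divisibility of the weight is exactly the condition on
    \<open>c j\<close> in the theorem: vacuous when 3 divides \<open>j\<close>.\<close>
  have dvd_w: "3 dvd ?w j \<longleftrightarrow> 3 dvd j \<or> 3 dvd c j" for j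
  proof -
    have "prime (3::int)" by simp
    then show ?thesis
      by (simp add: prime_dvd_mult_iff three_dvd_signed_size_iff int_dvd_int_iff[of 3, simplified])
  qed
  have "(\<forall>n\<ge>1. 3 dvd S c n) \<longleftrightarrow> (\<forall>j\<ge>1. 3 dvd ?w j)"
  proof
    assume w: "\<forall>j\<ge>1. 3 dvd ?w j"
    show "\<forall>n\<ge>1. 3 dvd S c n"
      unfolding S_eq_sum_part_occurrences using w by (intro allI impI dvd_sum dvd_mult2[where b = "?w j" for j]) auto
  next
    assume S: "\<forall>n\<ge>1. 3 dvd S c n"
    have "3 dvd ?w n" if "1 \<le> n" for n
      using that
    proof (induction n rule: less_induct)
      case (less n)
      \<comment> \<open>Split off the diagonal term, whose coefficient is 1. By induction 3 divides
        the terms with j < n, so it divides \<open>?w n\<close> as well.\<close>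
      have "{1..n} = insert n {1..<n}" using less.prems by auto
      then have "S c n = ?w n + (\<Sum>j = 1..<n. ?w j * int (part_occurrences c n j))"
        using less.prems by (simp add: S_eq_sum_part_occurrences part_occurrences_self)
      moreover have "3 dvd (\<Sum>j = 1..<n. ?w j * int (part_occurrences c n j))"
        using less.IH by (intro dvd_sum dvd_mult2[where b = "?w j" for j]) auto
      moreover have "3 dvd S c n" using S less.prems by blast
      ultimately show ?case by (simp add: dvd_add_left_iff)
    qed
    then show "\<forall>j\<ge>1. 3 dvd ?w j" by blast
  qed
  then show ?thesis unfolding dvd_w by (auto simp: cong_0_iff)
qed

end
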